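(* Let $(c_n)_{n\in\mathbb N}$ be a sequence of non-negative real numbers with $\sum_{n\in\mathbb N}c_n=1$, let $(\vartheta_n)_{n\in\mathbb N}$ be independent random variables, each uniformly distributed on $[0,2\pi)$, and put $\zeta_n=e^{i\vartheta_n}$. Let $\mu=\sum_{n\in\mathbb N}c_n\delta_{\zeta_n}$ and let $\varphi$ be the associated random inner function $$\varphi(z)=\frac{H\mu(z)-1}{H\mu(z)+1},\qquad H\mu(z)=\int_{\mathbb T}\frac{\zeta+z}{\zeta-z}\,d\mu(\zeta),\qquad z\in\mathbb D.$$ (i) If $\sum_n c_n^{1/2}<\infty$, then for every fixed $\xi\in\mathbb T$, almost surely $\varphi$ admits an angular derivative at $\xi$. (ii) If $\sum_n c_n^{1/2}=\infty$, then for every fixed $\xi\in\mathbb T$, the probability that $\varphi$ admits an angular derivative at $\xi$ is zero.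
   Context: $\mathbb D$ is the open unit disk in $\mathbb C$, $\mathbb T=\partial\mathbb D$. An inner function is an analytic map $\mathbb D\to\mathbb D$ with radial limits of modulus $1$ at Lebesgue-almost every point of $\mathbb T$; the random function $\varphi$ in the claim is inner. For $\zeta\in\mathbb T$, $\angle\lim_{z\to\zeta}$ denotes the non-tangential limit, i.e. the limit as $z\to\zeta$ with $z$ in a Stoltz region $\Gamma_\gamma(\zeta)=\{w\in\mathbb D:|w-\zeta|<\gamma(1-|w|)\}$, $\gamma>1$. An analytic self-map $\varphi$ of $\mathbb D$ has (admits) an angular derivative (in the sense of Carathéodory) at $\zeta\in\mathbb T$ if both: (1) the non-tangential limit $\kappa=\angle\lim_{z\to\zeta}\varphi(z)$ exists and belongs to $\mathbb T$; (2) the non-tangential limit $\angle\lim_{z\to\zeta}\varphi'(z)$ exists (and is finite). *)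

theory Defs
  imports "HOL-Probability.Probability"
begin

definition stolz_region :: "real \<Rightarrow> complex \<Rightarrow> complex set" where
  "stolz_region \<gamma> \<zeta> = {w \<in> ball 0 1. norm (w - \<zeta>) < \<gamma> * (1 - norm w)}"

text \<open>The aperture \<open>\<gamma>\<close> is arbitrary; the limit has to be the same for every aperture.\<close>

definition has_nontangential_limit :: "(complex \<Rightarrow> complex) \<Rightarrow> complex \<Rightarrow> complex \<Rightarrow> bool" where
  "has_nontangential_limit f \<zeta> l \<longleftrightarrow>
     (\<forall>\<gamma>>1. (f \<longlongrightarrow> l) (at \<zeta> within stolz_region \<gamma> \<zeta>))"

text \<open>Meant for analytic self-maps of the open unit disk. Only the values in the disk matter:
  the disk is open, so \<open>deriv f\<close> there does not see how \<open>f\<close> is continued outside.\<close>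

definition admits_angular_derivative :: "(complex \<Rightarrow> complex) \<Rightarrow> complex \<Rightarrow> bool" where
  "admits_angular_derivative f \<zeta> \<longleftrightarrow>
     (\<exists>\<kappa>\<in>sphere 0 1. has_nontangential_limit f \<zeta> \<kappa>) \<and>
     (\<exists>l. has_nontangential_limit (deriv f) \<zeta> l)"

abbreviation circle_borel :: "complex measure" where
  "circle_borel \<equiv> restrict_space borel (sphere 0 1)"

text \<open>The measure \<open>\<Sum>n. c n \<cdot> \<delta>\<^bsub>\<zeta> n\<^esub>\<close> on the unit circle, where \<open>return\<close> is the Dirac measure.\<close>

definition atomic_measure :: "(nat \<Rightarrow> real) \<Rightarrow> (nat \<Rightarrow> complex) \<Rightarrow> complex measure" where
  "atomic_measure c \<zeta> =
     measure_of (sphere 0 1) (sets circle_borel)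
       (\<lambda>A. \<Sum>n. ennreal (c n) * emeasure (return circle_borel (\<zeta> n)) A)"

lemma space_atomic_measure [simp]: "space (atomic_measure c \<zeta>) = sphere 0 1"
  and sets_atomic_measure [simp, measurable_cong]: "sets (atomic_measure c \<zeta>) = sets circle_borel"
proof -
  have "sets circle_borel \<subseteq> Pow (sphere 0 1)"
    using sets.space_closed[of circle_borel] by (simp add: space_restrict_space)
  then show "space (atomic_measure c \<zeta>) = sphere 0 1"
    unfolding atomic_measure_def by (rule space_measure_of)
  have "sphere 0 1 = space circle_borel" by (simp add: space_restrict_space)
  then show "sets (atomic_measure c \<zeta>) = sets circle_borel"
    unfolding atomic_measure_def by (metis sets.sets_measure_of_eq)
qed

lemma emeasure_atomic_measure:
  assumes A: "A \<in> sets circle_borel"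
  shows "emeasure (atomic_measure c \<zeta>) A =
    (\<Sum>n. ennreal (c n) * emeasure (return circle_borel (\<zeta> n)) A)"
proof (rule emeasure_measure_of[OF atomic_measure_def])
  show "sets circle_borel \<subseteq> Pow (sphere 0 1)"
    using sets.space_closed[of circle_borel] by (simp add: space_restrict_space)
  show "A \<in> sets (atomic_measure c \<zeta>)" using A by simp
  show "positive (sets (atomic_measure c \<zeta>))
     (\<lambda>A. \<Sum>n. ennreal (c n) * emeasure (return circle_borel (\<zeta> n)) A)"
    by (simp add: positive_def)
  show "countably_additive (sets (atomic_measure c \<zeta>))
     (\<lambda>A. \<Sum>n. ennreal (c n) * emeasure (return circle_borel (\<zeta> n)) A)"
  proof (rule countably_additiveI)
    fix B :: "nat \<Rightarrow> complex set"
    assume B: "range B \<subseteq> sets (atomic_measure c \<zeta>)" "disjoint_family B"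
    have U: "(\<Sum>i. emeasure (return circle_borel (\<zeta> n)) (B i)) =
        emeasure (return circle_borel (\<zeta> n)) (\<Union>i. B i)" for n
      using B by (intro suminf_emeasure) auto
    have "(\<Sum>i n. ennreal (c n) * emeasure (return circle_borel (\<zeta> n)) (B i)) =
          (\<Sum>n i. ennreal (c n) * emeasure (return circle_borel (\<zeta> n)) (B i))"
      using nn_integral_fst_count_space[of "\<lambda>(i, n). ennreal (c n) * emeasure (return circle_borel (\<zeta> n)) (B i)"]
        nn_integral_snd_count_space[of "\<lambda>(i, n). ennreal (c n) * emeasure (return circle_borel (\<zeta> n)) (B i)"]
      by (simp only: nn_integral_count_space_nat[symmetric] case_prod_conv)
    then show "(\<Sum>i n. ennreal (c n) * emeasure (return circle_borel (\<zeta> n)) (B i)) =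
          (\<Sum>n. ennreal (c n) * emeasure (return circle_borel (\<zeta> n)) (\<Union>i. B i))"
      by (simp only: ennreal_suminf_cmult U)
  qed
qed

definition herglotz :: "complex measure \<Rightarrow> complex \<Rightarrow> complex" where
  "herglotz \<mu> z = (\<integral>\<zeta>. (\<zeta> + z) / (\<zeta> - z) \<partial>\<mu>)"

definition associated_inner :: "complex measure \<Rightarrow> complex \<Rightarrow> complex" where
  "associated_inner \<mu> z = (herglotz \<mu> z - 1) / (herglotz \<mu> z + 1)"

end

theory Submission
  imports Defs
begin

text \<open>
  Everything reduces to one series. Write \<open>\<mu>\<close> for the atomic measure and \<open>H\<close> for its Herglotz transform, so
  that \<open>\<phi> = (H - 1) / (H + 1)\<close>. If \<open>\<xi>\<close> is a point of the circle carrying no atom, then \<open>\<phi>\<close> admits an angular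
  derivative at \<open>\<xi>\<close> if and only if \<open>\<Sum>n. c n / norm (\<zeta> n - \<xi>)\<^sup>2\<close> is finite
  (\<open>admits_angular_derivative_if_summable\<close> and \<open>summable_if_admits_angular_derivative\<close>). If the series
  converges, it dominates the series of \<open>H\<close> and of its derivative in every Stolz region, so both have
  nontangential limits. Conversely, an angular derivative makes \<open>\<phi>\<close> Lipschitz at the end of the radius,
  so that \<open>Re H(r\<xi>) / (1 - r)\<close> remains bounded, and this quotient is comparable with
  \<open>\<Sum>n. c n / norm (\<zeta> n - r\<xi>)\<^sup>2\<close>.

  For independent uniform angles no atom sits at \<open>\<xi>\<close>, almost surely, and the \<open>n\<close>-th term exceeds 1 exactly when
  \<open>\<zeta> n\<close> falls within distance \<open>sqrt (c n)\<close> of \<open>\<xi>\<close>. This event has probability of order \<open>sqrt (c n)\<close>. If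
  \<open>\<Sum>n. sqrt (c n)\<close> diverges, infinitely many terms exceed 1 by the second Borel-Cantelli lemma. If it
  converges, the damped terms \<open>c n / (c n + norm (\<zeta> n - \<xi>)\<^sup>2)\<close>, whose expectation is at most
  \<open>3 sqrt (c n)\<close>, have an almost surely finite sum, and convergence of the original series follows.
\<close>

section \<open>The Herglotz transform of an atomic measure\<close>

text \<open>One outcome of the random construction: \<open>c\<close> and \<open>\<zeta>\<close> are the weights and positions of the atoms.\<close>

locale circle_atoms =
  fixes c :: "nat \<Rightarrow> real" and \<zeta> :: "nat \<Rightarrow> complex"
  assumes c_nonneg: "0 \<le> c n"
    and c_sums_1: "c sums 1"
    and norm_\<zeta> [simp]: "norm (\<zeta> n) = 1"
begin

abbreviation "H \<equiv> herglotz (atomic_measure c \<zeta>)"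
abbreviation "\<phi> \<equiv> associated_inner (atomic_measure c \<zeta>)"

lemma summable_c: "summable c"
  using c_sums_1 by (simp add: sums_iff)

text \<open>As a push-forward of a weighted counting measure, the atomic measure turns integrals into series.\<close>

lemma atomic_measure_eq_distr:
  "atomic_measure c \<zeta> = distr (density (count_space UNIV) (\<lambda>n. ennreal (c n))) circle_borel \<zeta>"
proof (rule measure_eqI)
  show "sets (atomic_measure c \<zeta>) =
      sets (distr (density (count_space UNIV) (\<lambda>n. ennreal (c n))) circle_borel \<zeta>)"
    by simp
  fix A assume "A \<in> sets (atomic_measure c \<zeta>)"
  then have A: "A \<in> sets circle_borel" by simp
  have m: "\<zeta> \<in> measurable (density (count_space UNIV) (\<lambda>n. ennreal (c n))) circle_borel"
    by (auto simp: space_restrict_space)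
  show "emeasure (atomic_measure c \<zeta>) A =
      emeasure (distr (density (count_space UNIV) (\<lambda>n. ennreal (c n))) circle_borel \<zeta>) A"
    unfolding emeasure_atomic_measure[OF A] emeasure_distr[OF m A]
    by (subst emeasure_density)
       (auto simp: nn_integral_count_space_nat A indicator_def intro!: suminf_cong)
qed

lemma one_minus_norm_le_dist: "1 - norm z \<le> norm (\<zeta> n - z)"
  using norm_triangle_ineq2[of "\<zeta> n" z] by simp

lemma \<zeta>_neq_in_disc: "norm z < 1 \<Longrightarrow> \<zeta> n \<noteq> z"
  using norm_\<zeta>[of n] by auto

lemma norm_herglotz_kernel_le:
  assumes "norm z < 1"
  shows "norm (of_real (c n) * ((\<zeta> n + z) / (\<zeta> n - z))) \<le> c n * (2 / (1 - norm z))"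
proof -
  have "norm (\<zeta> n + z) \<le> 2"
    using norm_triangle_ineq[of "\<zeta> n" z] assms by simp
  then have "norm (\<zeta> n + z) / norm (\<zeta> n - z) \<le> 2 / (1 - norm z)"
    using assms one_minus_norm_le_dist[of z n] by (intro frac_le) auto
  from mult_left_mono[OF this c_nonneg[of n]] show ?thesis
    using c_nonneg[of n] by (simp add: norm_mult norm_divide)
qed

lemma herglotz_sums:
  assumes z: "norm z < 1"
  shows "(\<lambda>n. of_real (c n) * ((\<zeta> n + z) / (\<zeta> n - z))) sums H z"
proof -
  let ?k = "\<lambda>w. (w + z) / (w - z)"
  have k: "?k \<in> borel_measurable circle_borel"
    by (rule measurable_restrict_space1) measurable
  have m: "\<zeta> \<in> measurable (density (count_space UNIV) (\<lambda>n. ennreal (c n))) circle_borel"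
    by (auto simp: space_restrict_space)
  have "H z = (\<integral>n. ?k (\<zeta> n) \<partial>density (count_space UNIV) (\<lambda>n. ennreal (c n)))"
    unfolding herglotz_def atomic_measure_eq_distr by (rule integral_distr[OF m k])
  also have "\<dots> = (\<integral>n. c n *\<^sub>R ?k (\<zeta> n) \<partial>count_space UNIV)"
    by (rule integral_density) (auto simp: c_nonneg)
  finally have H: "H z = (\<integral>n. of_real (c n) * ?k (\<zeta> n) \<partial>count_space UNIV)"
    by (simp add: scaleR_conv_of_real)
  have "summable (\<lambda>n. norm (of_real (c n) * ?k (\<zeta> n)))"
    by (rule summable_comparison_test'[OF summable_mult2[OF summable_c, of "2 / (1 - norm z)"], of 0])
       (use norm_herglotz_kernel_le[OF z] in simp)
  then show ?thesis
    unfolding H by (intro sums_integral_count_space_nat) (simp add: integrable_count_space_nat_iff)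
qed

lemma has_field_derivative_herglotz:
  assumes z: "norm z < 1"
  shows "(H has_field_derivative (\<Sum>n. of_real (c n) * (2 * \<zeta> n / (\<zeta> n - z)\<^sup>2))) (at z)"
proof -
  obtain r where r: "norm z < r" "r < 1" using z dense by blast
  have "((\<lambda>w. \<Sum>n. of_real (c n) * ((\<zeta> n + w) / (\<zeta> n - w))) has_field_derivative
      (\<Sum>n. of_real (c n) * (2 * \<zeta> n / (\<zeta> n - z)\<^sup>2))) (at z)"
  proof (rule has_field_derivative_series'(2)[of "ball 0 r"])
    show "((\<lambda>w. of_real (c n) * ((\<zeta> n + w) / (\<zeta> n - w))) has_field_derivative
        of_real (c n) * (2 * \<zeta> n / (\<zeta> n - w)\<^sup>2)) (at w within ball 0 r)"
      if "w \<in> ball 0 r" for n w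
      using that r \<zeta>_neq_in_disc[of w n]
      by (auto intro!: derivative_eq_intros simp: power2_eq_square field_simps)
    have "norm (of_real (c n) * (2 * \<zeta> n / (\<zeta> n - w)\<^sup>2)) \<le> c n * (2 / (1 - r)\<^sup>2)"
      if "w \<in> ball 0 r" for n w
    proof -
      have "1 - r \<le> norm (\<zeta> n - w)"
        using that one_minus_norm_le_dist[of w n] by simp
      then have "2 / (norm (\<zeta> n - w))\<^sup>2 \<le> 2 / (1 - r)\<^sup>2"
        using r by (intro divide_left_mono power_mono mult_pos_pos zero_less_power) auto
      from mult_left_mono[OF this c_nonneg[of n]] show ?thesis
        using c_nonneg[of n] by (simp add: norm_mult norm_divide norm_power)
    qed
    then show "uniformly_convergent_on (ball 0 r)
        (\<lambda>n w. \<Sum>i<n. of_real (c i) * (2 * \<zeta> i / (\<zeta> i - w)\<^sup>2))"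
      by (rule Weierstrass_m_test'[OF _ summable_mult2[OF summable_c]])
    show "summable (\<lambda>n. of_real (c n) * ((\<zeta> n + z) / (\<zeta> n - z)))"
      using herglotz_sums[OF z] by (rule sums_summable)
  qed (use r in auto)
  moreover have "\<forall>\<^sub>F w in nhds z. H w = (\<Sum>n. of_real (c n) * ((\<zeta> n + w) / (\<zeta> n - w)))"
    by (rule eventually_mono[OF eventually_nhds_in_open[of "ball 0 1" z]])
       (use z in \<open>auto simp del: times_divide_eq_right intro!: sums_unique herglotz_sums\<close>)
  ultimately show ?thesis
    by (subst DERIV_cong_ev[OF refl _ refl]) auto
qed

end

text \<open>The real part of the Herglotz kernel is the Poisson kernel. The same identity with \<open>w = 1\<close> recovers
  \<open>Re H\<close> from \<open>\<phi>\<close>, because \<open>H = (1 + \<phi>) / (1 - \<phi>)\<close>.\<close>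

lemma Re_herglotz_kernel: "Re ((w + z) / (w - z)) = ((norm w)\<^sup>2 - (norm z)\<^sup>2) / (norm (w - z))\<^sup>2"
  by (simp add: Re_divide cmod_power2) (simp add: power2_eq_square algebra_simps)

context circle_atoms
begin

lemma Re_herglotz_sums:
  assumes "norm z < 1"
  shows "(\<lambda>n. c n * (1 - (norm z)\<^sup>2) / (norm (\<zeta> n - z))\<^sup>2) sums Re (H z)"
proof -
  have "Re (of_real (c n) * ((\<zeta> n + z) / (\<zeta> n - z))) = c n * (1 - (norm z)\<^sup>2) / (norm (\<zeta> n - z))\<^sup>2" for n
    by (simp only: Re_complex_of_real Im_complex_of_real times_complex.simps Re_herglotz_kernel norm_\<zeta>) simp
  with sums_Re[OF herglotz_sums[OF assms]] show ?thesis by simp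
qed

lemma Re_herglotz_nonneg:
  assumes "norm z < 1"
  shows "0 \<le> Re (H z)"
  using assms power_le_one[of "norm z" 2]
  by (intro sums_le[OF _ sums_zero Re_herglotz_sums[OF assms]])
     (auto intro!: mult_nonneg_nonneg divide_nonneg_nonneg c_nonneg)

lemma herglotz_plus_1_neq_0: "norm z < 1 \<Longrightarrow> H z + 1 \<noteq> 0"
  using Re_herglotz_nonneg[of z] by (metis Re_complex_of_real add.commute add_eq_0_iff neg_0_le_iff_le not_one_le_zero of_real_1 one_complex.sel(1) uminus_complex.sel(1))

lemma has_field_derivative_inner:
  assumes z: "norm z < 1"
  shows "(\<phi> has_field_derivative
    2 * (\<Sum>n. of_real (c n) * (2 * \<zeta> n / (\<zeta> n - z)\<^sup>2)) / (H z + 1)\<^sup>2) (at z)"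
  unfolding associated_inner_def[abs_def]
  using herglotz_plus_1_neq_0[OF z]
  by (auto intro!: derivative_eq_intros has_field_derivative_herglotz[OF z]
      simp: power2_eq_square field_simps)

lemma inner_eq: "norm z < 1 \<Longrightarrow> \<phi> z = 1 - 2 / (H z + 1)"
  using herglotz_plus_1_neq_0[of z] by (simp add: associated_inner_def field_simps)

lemma herglotz_eq_inner:
  assumes "norm z < 1"
  shows "H z = (1 + \<phi> z) / (1 - \<phi> z)"
proof -
  have "1 + \<phi> z = 2 * H z / (H z + 1)" "1 - \<phi> z = 2 / (H z + 1)"
    using herglotz_plus_1_neq_0[OF assms] by (simp_all add: inner_eq[OF assms] field_simps)
  then show ?thesis
    using herglotz_plus_1_neq_0[OF assms] by simp
qed

end

section \<open>Angular derivatives and a summability criterion\<close>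

context circle_atoms
begin

text \<open>In a Stolz region the distance from \<open>z\<close> to an atom cannot be much smaller than that from \<open>\<xi>\<close>:
  \<open>norm (z - \<xi>)\<close> is at most \<open>\<gamma>\<close> times the distance of \<open>z\<close> to the circle, on which the atom lies. This makes
  the series for \<open>H\<close> and its derivative dominated by one summable sequence.\<close>

lemma stolz_dist_le:
  assumes "z \<in> stolz_region \<gamma> \<xi>"
  shows "norm (\<zeta> n - \<xi>) \<le> (1 + \<gamma>) * norm (\<zeta> n - z)"
proof -
  have z: "norm z < 1" "norm (z - \<xi>) < \<gamma> * (1 - norm z)"
    using assms by (auto simp: stolz_region_def)
  have "\<gamma> > 0"
    using z norm_ge_zero[of "z - \<xi>"] zero_less_mult_pos2[of \<gamma> "1 - norm z"] by linarith
  then have "\<gamma> * (1 - norm z) \<le> \<gamma> * norm (\<zeta> n - z)"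
    using one_minus_norm_le_dist[of z n] by simp
  with z norm_triangle_ineq[of "\<zeta> n - z" "z - \<xi>"] show ?thesis
    by (simp add: algebra_simps)
qed

text \<open>Chords have length at most 2, so the first-order kernel is dominated by the second-order one; hence a
  single summability assumption controls both \<open>H\<close> and its derivative.\<close>

lemma norm_herglotz_kernel_le_square:
  assumes "\<zeta> n \<noteq> z" "norm z \<le> 1"
  shows "norm (of_real (c n) * ((\<zeta> n + z) / (\<zeta> n - z))) \<le> 4 * (c n / (norm (\<zeta> n - z))\<^sup>2)"
proof -
  have "norm (\<zeta> n + z) \<le> 2" "norm (\<zeta> n - z) \<le> 2"
    using norm_triangle_ineq[of "\<zeta> n" z] norm_triangle_ineq4[of "\<zeta> n" z] assms(2) by auto
  then have "norm (\<zeta> n + z) * norm (\<zeta> n - z) \<le> 2 * 2"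
    by (intro mult_mono) auto
  then have "norm (\<zeta> n + z) / norm (\<zeta> n - z) \<le> 4 / (norm (\<zeta> n - z))\<^sup>2"
    using assms(1) by (simp add: field_simps power2_eq_square)
  from mult_left_mono[OF this c_nonneg[of n]] show ?thesis
    using c_nonneg[of n] by (simp add: norm_mult norm_divide mult_ac)
qed

text \<open>By dominated convergence, \<open>H\<close> and its derivative converge to the series evaluated at \<open>\<xi>\<close>. The Poisson kernel vanishes
  at \<open>\<xi>\<close>, so the limit \<open>h\<close> of \<open>H\<close> is purely imaginary; this puts \<open>(h - 1) / (h + 1)\<close> on the circle and
  keeps the denominator away from 0.\<close>

theorem admits_angular_derivative_if_summable:
  assumes \<xi>: "norm \<xi> = 1" and neq: "\<And>n. \<zeta> n \<noteq> \<xi>"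
    and summ: "summable (\<lambda>n. c n / (norm (\<zeta> n - \<xi>))\<^sup>2)"
  shows "admits_angular_derivative \<phi> \<xi>"
proof -
  define h where "h = (\<Sum>n. of_real (c n) * ((\<zeta> n + \<xi>) / (\<zeta> n - \<xi>)))"
  define h' where "h' = (\<Sum>n. of_real (c n) * (2 * \<zeta> n / (\<zeta> n - \<xi>)\<^sup>2))"
  have pos: "norm (\<zeta> n - \<xi>) > 0" for n using neq[of n] by simp
  have "summable (\<lambda>n. of_real (c n) * ((\<zeta> n + \<xi>) / (\<zeta> n - \<xi>)))"
    using norm_herglotz_kernel_le_square[OF neq] \<xi>
    by (intro summable_norm_cancel[OF summable_comparison_test'[OF summable_mult[OF summ, of 4], of 0]]) simp
  then have "Re h = (\<Sum>n. Re (of_real (c n) * ((\<zeta> n + \<xi>) / (\<zeta> n - \<xi>))))"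
    unfolding h_def by (rule Re_suminf)
  also have "\<dots> = 0"
    by (simp only: Re_complex_of_real Im_complex_of_real times_complex.simps Re_herglotz_kernel norm_\<zeta> \<xi>) simp
  finally have Re_h: "Re h = 0" .
  then have h1: "h + 1 \<noteq> 0" by (auto simp: complex_eq_iff)
  have H_lim: "(H \<longlongrightarrow> h) (at \<xi> within stolz_region \<gamma> \<xi>)"
    and H'_lim: "((\<lambda>z. \<Sum>n. of_real (c n) * (2 * \<zeta> n / (\<zeta> n - z)\<^sup>2)) \<longlongrightarrow> h') (at \<xi> within stolz_region \<gamma> \<xi>)"
    if \<gamma>: "\<gamma> > 1" for \<gamma>
  proof -
    let ?F = "at \<xi> within stolz_region \<gamma> \<xi>"
    have in_F: "\<forall>\<^sub>F z in ?F. z \<in> stolz_region \<gamma> \<xi>"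
      by (auto simp: eventually_at_filter)
    have in_prod: "\<forall>\<^sub>F (n, z) in at_top \<times>\<^sub>F ?F. P n z"
      if "\<And>n z. z \<in> stolz_region \<gamma> \<xi> \<Longrightarrow> P n z" for P :: "nat \<Rightarrow> complex \<Rightarrow> bool"
      unfolding eventually_prod_filter using that in_F
      by (intro exI[of _ "\<lambda>_. True"] exI[of _ "\<lambda>z. z \<in> stolz_region \<gamma> \<xi>"]) auto
    let ?K = "4 * (1 + \<gamma>)\<^sup>2"
    have summ': "summable (\<lambda>n. ?K * (c n / (norm (\<zeta> n - \<xi>))\<^sup>2))"
      by (rule summable_mult[OF summ])
    have le: "4 * (c n / (norm (\<zeta> n - z))\<^sup>2) \<le> ?K * (c n / (norm (\<zeta> n - \<xi>))\<^sup>2)"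
      if "z \<in> stolz_region \<gamma> \<xi>" for n z
    proof -
      have "(norm (\<zeta> n - \<xi>))\<^sup>2 \<le> (1 + \<gamma>)\<^sup>2 * (norm (\<zeta> n - z))\<^sup>2"
        using power_mono[OF stolz_dist_le[OF that, of n], of 2] by (simp add: power_mult_distrib)
      moreover have "norm (\<zeta> n - z) > 0"
        using \<zeta>_neq_in_disc[of z n] that by (simp add: stolz_region_def)
      ultimately have "1 / (norm (\<zeta> n - z))\<^sup>2 \<le> (1 + \<gamma>)\<^sup>2 / (norm (\<zeta> n - \<xi>))\<^sup>2"
        using pos[of n] by (simp add: field_simps)
      from mult_left_mono[OF this, of "4 * c n"] c_nonneg[of n] show ?thesis
        by (simp add: mult_ac)
    qed
    have bound: "norm (of_real (c n) * ((\<zeta> n + z) / (\<zeta> n - z))) \<le> ?K * (c n / (norm (\<zeta> n - \<xi>))\<^sup>2)"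
      if z: "z \<in> stolz_region \<gamma> \<xi>" for n z
    proof -
      have "norm z < 1" using z by (simp add: stolz_region_def)
      then show ?thesis
        using norm_herglotz_kernel_le_square[OF \<zeta>_neq_in_disc, of z n] le[OF z, of n] by linarith
    qed
    have bound': "norm (of_real (c n) * (2 * \<zeta> n / (\<zeta> n - z)\<^sup>2)) \<le> ?K * (c n / (norm (\<zeta> n - \<xi>))\<^sup>2)"
      if "z \<in> stolz_region \<gamma> \<xi>" for n z
    proof -
      have "norm (of_real (c n) * (2 * \<zeta> n / (\<zeta> n - z)\<^sup>2)) = 2 * (c n / (norm (\<zeta> n - z))\<^sup>2)"
        using c_nonneg[of n] by (simp add: norm_mult norm_divide norm_power)
      also have "\<dots> \<le> 4 * (c n / (norm (\<zeta> n - z))\<^sup>2)"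
        using c_nonneg[of n] by (intro mult_right_mono) auto
      finally show ?thesis using le[OF that, of n] by linarith
    qed
    have "((\<lambda>z. \<Sum>n. of_real (c n) * ((\<zeta> n + z) / (\<zeta> n - z))) \<longlongrightarrow> h) ?F"
    proof (cases "?F = bot")
      case False
      have lim: "((\<lambda>z. of_real (c n) * ((\<zeta> n + z) / (\<zeta> n - z))) \<longlongrightarrow> of_real (c n) * ((\<zeta> n + \<xi>) / (\<zeta> n - \<xi>))) ?F" for n
        using neq[of n] by (intro tendsto_intros) auto
      show ?thesis
        unfolding h_def
        using tannerys_theorem[OF lim in_prod[OF bound] summ' False] by blast
    qed simp
    then show "(H \<longlongrightarrow> h) ?F"
    proof (rule Lim_transform_eventually)
      show "\<forall>\<^sub>F z in ?F. (\<Sum>n. of_real (c n) * ((\<zeta> n + z) / (\<zeta> n - z))) = H z"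
        using in_F by eventually_elim
          (rule sums_unique[OF herglotz_sums, symmetric], simp add: stolz_region_def)
    qed
    show "((\<lambda>z. \<Sum>n. of_real (c n) * (2 * \<zeta> n / (\<zeta> n - z)\<^sup>2)) \<longlongrightarrow> h') ?F"
    proof (cases "?F = bot")
      case False
      have lim: "((\<lambda>z. of_real (c n) * (2 * \<zeta> n / (\<zeta> n - z)\<^sup>2)) \<longlongrightarrow> of_real (c n) * (2 * \<zeta> n / (\<zeta> n - \<xi>)\<^sup>2)) ?F" for n
        using neq[of n] by (intro tendsto_intros) auto
      show ?thesis
        unfolding h'_def
        using tannerys_theorem[OF lim in_prod[OF bound'] summ' False] by blast
    qed simp
  qed
  have "norm (h - 1) = norm (h + 1)"
    using Re_h by (simp add: cmod_def)
  then have "norm ((h - 1) / (h + 1)) = 1"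
    using h1 unfolding norm_divide by simp
  moreover have "has_nontangential_limit \<phi> \<xi> ((h - 1) / (h + 1))"
    unfolding has_nontangential_limit_def associated_inner_def[abs_def]
    using h1 by (auto intro!: tendsto_intros H_lim)
  moreover have "has_nontangential_limit (deriv \<phi>) \<xi> (2 * h' / (h + 1)\<^sup>2)"
    unfolding has_nontangential_limit_def
  proof (intro allI impI)
    fix \<gamma> :: real assume \<gamma>: "1 < \<gamma>"
    have "((\<lambda>z. 2 * (\<Sum>n. of_real (c n) * (2 * \<zeta> n / (\<zeta> n - z)\<^sup>2)) / (H z + 1)\<^sup>2) \<longlongrightarrow> 2 * h' / (h + 1)\<^sup>2)
        (at \<xi> within stolz_region \<gamma> \<xi>)"
      using h1 by (intro tendsto_intros H_lim H'_lim \<gamma>) auto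
    then show "(deriv \<phi> \<longlongrightarrow> 2 * h' / (h + 1)\<^sup>2) (at \<xi> within stolz_region \<gamma> \<xi>)"
    proof (rule Lim_transform_eventually)
      have "\<forall>\<^sub>F z in at \<xi> within stolz_region \<gamma> \<xi>. z \<in> stolz_region \<gamma> \<xi>"
        by (auto simp: eventually_at_filter)
      then show "\<forall>\<^sub>F z in at \<xi> within stolz_region \<gamma> \<xi>.
          2 * (\<Sum>n. of_real (c n) * (2 * \<zeta> n / (\<zeta> n - z)\<^sup>2)) / (H z + 1)\<^sup>2 = deriv \<phi> z"
        by eventually_elim
          (rule DERIV_imp_deriv[OF has_field_derivative_inner, symmetric], simp add: stolz_region_def)
    qed
  qed
  ultimately show ?thesis
    unfolding admits_angular_derivative_def by (auto simp: dist_norm)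
qed

end

text \<open>The radius at \<open>\<xi>\<close> lies in every Stolz region, since \<open>norm (r\<xi> - \<xi>) = 1 - r\<close>.\<close>

lemma filterlim_radius_stolz:
  assumes "norm \<xi> = 1" "\<gamma> > 1"
  shows "filterlim (\<lambda>r. of_real r * \<xi>) (at \<xi> within stolz_region \<gamma> \<xi>) (at_left (1::real))"
  unfolding filterlim_at
proof
  have "((\<lambda>r. of_real r * \<xi>) \<longlongrightarrow> of_real 1 * \<xi>) (at_left (1::real))"
    by (intro tendsto_intros)
  then show "((\<lambda>r. of_real r * \<xi>) \<longlongrightarrow> \<xi>) (at_left (1::real))" by simp
  have "\<forall>\<^sub>F r in at_left (1::real). r \<in> {0<..<1}"
    by (rule eventually_at_left_real) simp
  then show "\<forall>\<^sub>F r in at_left (1::real). of_real r * \<xi> \<in> stolz_region \<gamma> \<xi> \<and> of_real r * \<xi> \<noteq> \<xi>"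
  proof eventually_elim
    case (elim r)
    have "of_real r * \<xi> - \<xi> = - (of_real (1 - r) * \<xi>)" by (simp add: algebra_simps)
    then have "norm (of_real r * \<xi> - \<xi>) = 1 - r"
      using elim assms by (simp only: norm_minus_cancel norm_mult norm_of_real) simp
    with elim assms show ?case
      by (auto simp: stolz_region_def norm_mult)
  qed
qed

text \<open>A limit of the derivative bounds it near the end of the radius; the mean value inequality between
  \<open>r\<close> and \<open>s\<close>, followed by \<open>s \<longlongrightarrow> 1\<close>, then compares \<open>f\<close> with its boundary value.\<close>

lemma radial_lipschitz_if_nontangential_limits:
  assumes diff: "\<And>z. norm z < 1 \<Longrightarrow> (f has_field_derivative deriv f z) (at z)"
    and f: "has_nontangential_limit f \<xi> \<kappa>" and f': "has_nontangential_limit (deriv f) \<xi> l"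
    and \<xi>: "norm \<xi> = 1"
  shows "\<exists>C>0. \<forall>\<^sub>F r in at_left (1::real). norm (f (of_real r * \<xi>) - \<kappa>) \<le> C * (1 - r)"
proof -
  define C where "C = norm l + 1"
  have lim: "filterlim (\<lambda>r. of_real r * \<xi>) (at \<xi> within stolz_region 2 \<xi>) (at_left (1::real))"
    by (rule filterlim_radius_stolz[OF \<xi>]) simp
  have f_lim: "((\<lambda>r. f (of_real r * \<xi>)) \<longlongrightarrow> \<kappa>) (at_left (1::real))"
    using f by (intro filterlim_compose[OF _ lim]) (simp add: has_nontangential_limit_def)
  have "((\<lambda>r. deriv f (of_real r * \<xi>)) \<longlongrightarrow> l) (at_left (1::real))"
    using f' by (intro filterlim_compose[OF _ lim]) (simp add: has_nontangential_limit_def)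
  from order_tendstoD(2)[OF tendsto_norm[OF this], of C]
  have "\<forall>\<^sub>F r in at_left (1::real). norm (deriv f (of_real r * \<xi>)) < C"
    by (simp add: C_def)
  then obtain a where a: "a < 1" "\<And>r. a < r \<Longrightarrow> r < 1 \<Longrightarrow> norm (deriv f (of_real r * \<xi>)) < C"
    unfolding eventually_at_left_field by blast
  \<comment> \<open>Only nonnegative radii stay in the disc.\<close>
  define b where "b = max a 0"
  define S where "S = (\<lambda>r. of_real r * \<xi>) ` {b<..<1}"
  have S: "convex S"
  proof -
    have "linear (\<lambda>r. r *\<^sub>R \<xi>)"
      by (rule linearI) (simp_all add: scaleR_left_distrib)
    then have "convex ((\<lambda>r. r *\<^sub>R \<xi>) ` {b<..<1})"
      by (rule convex_linear_image) simp
    then show ?thesis by (simp only: S_def scaleR_conv_of_real)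
  qed
  have lip: "norm (f (of_real r * \<xi>) - f (of_real s * \<xi>)) \<le> C * norm (of_real r * \<xi> - of_real s * \<xi>)"
    if "r \<in> {b<..<1}" "s \<in> {b<..<1}" for r s
  proof (rule field_differentiable_bound[OF S, where f = f and f' = "deriv f"])
    show "(f has_field_derivative deriv f z) (at z within S)" if z: "z \<in> S" for z
    proof -
      obtain r where "r \<in> {b<..<1}" "z = of_real r * \<xi>" using z unfolding S_def by blast
      then show ?thesis
        using \<xi> by (intro has_field_derivative_at_within[OF diff]) (simp add: b_def norm_mult)
    qed
    show "norm (deriv f z) \<le> C" if z: "z \<in> S" for z
    proof -
      obtain r where "r \<in> {b<..<1}" "z = of_real r * \<xi>" using z unfolding S_def by blast
      then show ?thesis
        using a(2)[of r] by (simp add: b_def)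
    qed
    show "of_real r * \<xi> \<in> S" "of_real s * \<xi> \<in> S"
      unfolding S_def by (rule imageI[OF that(1)], rule imageI[OF that(2)])
  qed
  have "norm (f (of_real r * \<xi>) - \<kappa>) \<le> C * (1 - r)" if r: "r \<in> {b<..<1}" for r
  proof (rule tendsto_le[of "at_left (1::real)"])
    have "((\<lambda>s. C * norm (of_real r * \<xi> - of_real s * \<xi>)) \<longlongrightarrow> C * norm (of_real r * \<xi> - of_real 1 * \<xi>)) (at_left (1::real))"
      by (intro tendsto_intros)
    moreover have "norm (of_real r * \<xi> - of_real 1 * \<xi>) = 1 - r"
      using r \<xi> unfolding left_diff_distrib[symmetric] of_real_diff[symmetric] norm_mult norm_of_real by simp
    ultimately show "((\<lambda>s. C * norm (of_real r * \<xi> - of_real s * \<xi>)) \<longlongrightarrow> C * (1 - r)) (at_left (1::real))"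
      by simp
    show "((\<lambda>s. norm (f (of_real r * \<xi>) - f (of_real s * \<xi>))) \<longlongrightarrow> norm (f (of_real r * \<xi>) - \<kappa>)) (at_left (1::real))"
      by (intro tendsto_intros f_lim)
    have "\<forall>\<^sub>F s in at_left (1::real). s \<in> {b<..<1}"
      by (rule eventually_at_left_real) (use a in \<open>simp add: b_def\<close>)
    then show "\<forall>\<^sub>F s in at_left (1::real). norm (f (of_real r * \<xi>) - f (of_real s * \<xi>)) \<le> C * norm (of_real r * \<xi> - of_real s * \<xi>)"
      by eventually_elim (rule lip[OF r])
  qed simp
  moreover have "\<forall>\<^sub>F r in at_left (1::real). r \<in> {b<..<1}"
    by (rule eventually_at_left_real) (use a in \<open>simp add: b_def\<close>)
  ultimately have "\<forall>\<^sub>F r in at_left (1::real). norm (f (of_real r * \<xi>) - \<kappa>) \<le> C * (1 - r)"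
    by (auto elim: eventually_mono)
  moreover have "C > 0" by (simp add: C_def add_nonneg_pos)
  ultimately show ?thesis by blast
qed

context circle_atoms
begin

text \<open>The radial Lipschitz bound reads \<open>norm (\<phi> - \<kappa>) \<le> C (1 - r)\<close>. If \<open>\<kappa> = 1\<close>, then \<open>1 - \<phi> = 2 / (H + 1)\<close>
  forces \<open>(1 - r) H\<close> to stay away from 0; but \<open>(1 - r) H(r\<xi>)\<close> tends to twice the mass of \<open>\<mu>\<close> at \<open>\<xi>\<close>,
  which is 0. Hence \<open>\<kappa> \<noteq> 1\<close>, and \<open>Re H = (1 - norm \<phi>\<^sup>2) / norm (1 - \<phi>)\<^sup>2\<close> is bounded by a
  multiple of \<open>1 - r\<close>. Dividing the Poisson series of \<open>Re H\<close> by \<open>1 - r\<^sup>2\<close> and letting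
  \<open>r \<longlongrightarrow> 1\<close> in its partial sums gives the claim.\<close>

theorem summable_if_admits_angular_derivative:
  assumes \<xi>: "norm \<xi> = 1" and neq: "\<And>n. \<zeta> n \<noteq> \<xi>"
    and ang: "admits_angular_derivative \<phi> \<xi>"
  shows "summable (\<lambda>n. c n / (norm (\<zeta> n - \<xi>))\<^sup>2)"
proof -
  obtain \<kappa> l where \<kappa>: "norm \<kappa> = 1" "has_nontangential_limit \<phi> \<xi> \<kappa>"
    and l: "has_nontangential_limit (deriv \<phi>) \<xi> l"
    using ang by (auto simp: admits_angular_derivative_def dist_norm)
  let ?z = "\<lambda>r::real. of_real r * \<xi>"
  have norm_z: "norm (?z r) < 1" if "r \<in> {0<..<1}" for r
    using that \<xi> by (simp add: norm_mult)
  have unit: "\<forall>\<^sub>F r in at_left (1::real). r \<in> {0<..<1}"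
    by (rule eventually_at_left_real) simp
  have deriv: "(\<phi> has_field_derivative deriv \<phi> z) (at z)" if "norm z < 1" for z
    using has_field_derivative_inner[OF that] DERIV_deriv_iff_field_differentiable
      field_differentiable_def by blast
  obtain C where C: "C > 0"
    "\<forall>\<^sub>F r in at_left (1::real). norm (\<phi> (?z r) - \<kappa>) \<le> C * (1 - r)"
    using radial_lipschitz_if_nontangential_limits[OF deriv \<kappa>(2) l \<xi>] by blast
  have \<phi>_lim: "((\<lambda>r. \<phi> (?z r)) \<longlongrightarrow> \<kappa>) (at_left (1::real))"
    using \<kappa>(2) by (intro filterlim_compose[OF _ filterlim_radius_stolz[OF \<xi>, of 2]])
      (simp_all add: has_nontangential_limit_def)
  have r_H_lim: "((\<lambda>r. \<Sum>n. of_real (1 - r) * (of_real (c n) * ((\<zeta> n + ?z r) / (\<zeta> n - ?z r)))) \<longlongrightarrow> (\<Sum>n::nat. 0)) (at_left (1::real))"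
  proof -
    have lim: "((\<lambda>r. of_real (1 - r) * (of_real (c n) * ((\<zeta> n + ?z r) / (\<zeta> n - ?z r)))) \<longlongrightarrow> 0) (at_left (1::real))" for n
    \<comment> \<open>The factor \<open>1 - r\<close> vanishes while the kernel stays finite, because \<open>\<xi>\<close> is not an atom.\<close>
    proof -
      have "((\<lambda>r. of_real (1 - r) * (of_real (c n) * ((\<zeta> n + ?z r) / (\<zeta> n - ?z r)))) \<longlongrightarrow>
          of_real (1 - 1) * (of_real (c n) * ((\<zeta> n + ?z 1) / (\<zeta> n - ?z 1)))) (at_left (1::real))"
        using neq[of n] by (intro tendsto_intros) auto
      then show ?thesis by simp
    qed
    have "norm (of_real (1 - r) * (of_real (c n) * ((\<zeta> n + ?z r) / (\<zeta> n - ?z r)))) \<le> 2 * c n"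
      if r: "r \<in> {0<..<1}" for n r
    proof -
      have "norm (?z r) = r" using r \<xi> by (simp add: norm_mult)
      then have "(1 - r) * norm (of_real (c n) * ((\<zeta> n + ?z r) / (\<zeta> n - ?z r))) \<le> (1 - r) * (c n * (2 / (1 - r)))"
        using norm_herglotz_kernel_le[OF norm_z[OF r], of n] r by (intro mult_left_mono) auto
      also have "\<dots> = 2 * c n" using r by simp
      finally show ?thesis
        unfolding norm_mult[of "of_real (1 - r)"] norm_of_real using r by simp
    qed
    then have "\<forall>\<^sub>F (n, r) in at_top \<times>\<^sub>F at_left (1::real).
        norm (of_real (1 - r) * (of_real (c n) * ((\<zeta> n + ?z r) / (\<zeta> n - ?z r)))) \<le> 2 * c n"
      unfolding eventually_prod_filter using unit
      by (intro exI[of _ "\<lambda>_. True"] exI[of _ "\<lambda>r. r \<in> {0<..<1}"]) auto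
    from tannerys_theorem[OF lim this summable_mult[OF summable_c]] show ?thesis by auto
  qed
  have r_H: "((\<lambda>r. of_real (1 - r) * H (?z r)) \<longlongrightarrow> 0) (at_left (1::real))"
  proof (rule Lim_transform_eventually)
    show "((\<lambda>r. \<Sum>n. of_real (1 - r) * (of_real (c n) * ((\<zeta> n + ?z r) / (\<zeta> n - ?z r)))) \<longlongrightarrow> 0) (at_left (1::real))"
      using r_H_lim by simp
    show "\<forall>\<^sub>F r in at_left (1::real). (\<Sum>n. of_real (1 - r) * (of_real (c n) * ((\<zeta> n + ?z r) / (\<zeta> n - ?z r)))) = of_real (1 - r) * H (?z r)"
      using unit by eventually_elim (rule sums_unique[OF sums_mult[OF herglotz_sums[OF norm_z]], symmetric])
  qed
  have "\<kappa> \<noteq> 1"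
  proof
    assume "\<kappa> = 1"
    have "((\<lambda>r. norm (of_real (1 - r) * H (?z r) + of_real (1 - r))) \<longlongrightarrow> norm (0 + of_real (1 - 1) :: complex)) (at_left (1::real))"
      by (intro tendsto_intros r_H)
    then have "\<forall>\<^sub>F r in at_left (1::real). norm (of_real (1 - r) * H (?z r) + of_real (1 - r)) < 2 / C"
      using C by (intro order_tendstoD) auto
    then have "\<forall>\<^sub>F r in at_left (1::real). False"
      using C(2) unit
    proof eventually_elim
      case (elim r)
      have nz: "norm (H (?z r) + 1) > 0" using herglotz_plus_1_neq_0[OF norm_z[OF elim(3)]] by simp
      have "norm (2 / (H (?z r) + 1)) \<le> C * (1 - r)"
        using elim(2) \<open>\<kappa> = 1\<close> by (simp add: inner_eq[OF norm_z[OF elim(3)]])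
      then have "2 / norm (H (?z r) + 1) \<le> C * (1 - r)"
        by (simp add: norm_divide)
      then have "2 \<le> C * ((1 - r) * norm (H (?z r) + 1))"
        using nz by (simp add: field_simps)
      also have "(1 - r) * norm (H (?z r) + 1) = norm (of_real (1 - r) * (H (?z r) + 1))"
        unfolding norm_mult norm_of_real using elim(3) by simp
      also have "of_real (1 - r) * (H (?z r) + 1) = of_real (1 - r) * H (?z r) + of_real (1 - r)"
        by (simp add: algebra_simps)
      also have "C * norm \<dots> < C * (2 / C)"
        using elim(1) C(1) by (rule mult_strict_left_mono)
      finally show False using C(1) by simp
    qed
    then show False by simp
  qed
  \<comment> \<open>Half the distance, so that \<open>1 - \<phi>\<close> is eventually longer than \<open>d\<close>.\<close>
  define d where "d = norm (1 - \<kappa>) / 2"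
  have d: "d > 0" using \<open>\<kappa> \<noteq> 1\<close> by (simp add: d_def)
  have "((\<lambda>r. norm (1 - \<phi> (?z r))) \<longlongrightarrow> norm (1 - \<kappa>)) (at_left (1::real))"
    by (intro tendsto_intros \<phi>_lim)
  then have far: "\<forall>\<^sub>F r in at_left (1::real). d < norm (1 - \<phi> (?z r))"
    using d by (intro order_tendstoD) (auto simp: d_def)
  have Re_le: "\<forall>\<^sub>F r in at_left (1::real). Re (H (?z r)) \<le> (2 * C / d\<^sup>2) * (1 - r\<^sup>2)"
    using far C(2) unit
  proof eventually_elim
    case (elim r)
    let ?w = "\<phi> (?z r)"
    have z: "norm (?z r) < 1" by (rule norm_z[OF elim(3)])
    have w1: "1 - ?w \<noteq> 0" using elim(1) d by auto
    have Re_H: "Re (H (?z r)) = (1 - (norm ?w)\<^sup>2) / (norm (1 - ?w))\<^sup>2"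
      unfolding herglotz_eq_inner[OF z] Re_herglotz_kernel by simp
    then have "0 \<le> (1 - (norm ?w)\<^sup>2) / (norm (1 - ?w))\<^sup>2"
      using Re_herglotz_nonneg[OF z] by simp
    then have nonneg: "0 \<le> 1 - (norm ?w)\<^sup>2"
      using w1 by (simp add: zero_le_divide_iff)
    have "1 - norm ?w \<le> C * (1 - r)"
      using norm_triangle_ineq2[of \<kappa> ?w] \<kappa>(1) elim(2) by (simp add: norm_minus_commute)
    moreover have w2: "1 - (norm ?w)\<^sup>2 \<le> 2 * (1 - norm ?w)"
      using zero_le_power2[of "1 - norm ?w"] by (simp add: power2_eq_square algebra_simps)
    moreover have "C * (1 - r) \<le> C * (1 - r\<^sup>2)"
      using elim(3) C(1) by (intro mult_left_mono) (auto simp: power2_eq_square mult_left_le)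
    ultimately have "1 - norm ?w \<le> C * (1 - r\<^sup>2)" by (meson order_trans)
    then have "2 * (1 - norm ?w) \<le> 2 * (C * (1 - r\<^sup>2))" by (rule mult_left_mono) simp
    with w2 have "1 - (norm ?w)\<^sup>2 \<le> 2 * C * (1 - r\<^sup>2)"
      unfolding mult.assoc[of 2 C] by (rule order_trans)
    moreover have "d\<^sup>2 \<le> (norm (1 - ?w))\<^sup>2"
      using elim(1) d by (intro power_mono) auto
    ultimately have "(1 - (norm ?w)\<^sup>2) / (norm (1 - ?w))\<^sup>2 \<le> 2 * C * (1 - r\<^sup>2) / d\<^sup>2"
      using nonneg d by (intro frac_le) auto
    then show ?case by (simp add: Re_H)
  qed
  have partial: "(\<Sum>n<N. c n / (norm (\<zeta> n - \<xi>))\<^sup>2) \<le> 2 * C / d\<^sup>2" for N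
  proof (rule tendsto_le[of "at_left (1::real)"])
    have "((\<lambda>r. \<Sum>n<N. c n / (norm (\<zeta> n - ?z r))\<^sup>2) \<longlongrightarrow> (\<Sum>n<N. c n / (norm (\<zeta> n - of_real 1 * \<xi>))\<^sup>2)) (at_left (1::real))"
      using neq by (intro tendsto_intros) auto
    then show "((\<lambda>r. \<Sum>n<N. c n / (norm (\<zeta> n - ?z r))\<^sup>2) \<longlongrightarrow> (\<Sum>n<N. c n / (norm (\<zeta> n - \<xi>))\<^sup>2)) (at_left (1::real))"
      by simp
    show "\<forall>\<^sub>F r in at_left (1::real). (\<Sum>n<N. c n / (norm (\<zeta> n - ?z r))\<^sup>2) \<le> 2 * C / d\<^sup>2"
      using Re_le unit
    proof eventually_elim
      case (elim r)
      have r: "norm (?z r) = r" "1 - r\<^sup>2 > 0"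
        using elim(2) \<xi> by (auto simp: norm_mult power_less_one_iff abs_square_less_1)
      have s: "(\<lambda>n. c n * (1 - r\<^sup>2) / (norm (\<zeta> n - ?z r))\<^sup>2) sums Re (H (?z r))"
        using Re_herglotz_sums[OF norm_z[OF elim(2)]] r by simp
      have "(\<Sum>n<N. c n / (norm (\<zeta> n - ?z r))\<^sup>2) * (1 - r\<^sup>2) = (\<Sum>n<N. c n * (1 - r\<^sup>2) / (norm (\<zeta> n - ?z r))\<^sup>2)"
        by (simp add: sum_distrib_right)
      also have "\<dots> \<le> Re (H (?z r))"
        using r c_nonneg unfolding sums_unique[OF s]
        by (intro sum_le_suminf sums_summable[OF s]) auto
      also note elim(1)
      finally show ?case using r(2) by (rule mult_right_le_imp_le)
    qed
  qed simp_all
  show ?thesis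
    by (rule summableI_nonneg_bounded[OF _ partial]) (simp add: c_nonneg)
qed

end

section \<open>Chords, arcs and uniformly distributed points\<close>

lemma norm_cis_minus_1: "norm (cis s - 1) = 2 * \<bar>sin (s / 2)\<bar>"
proof -
  have "(norm (cis s - 1))\<^sup>2 = (2 * \<bar>sin (s / 2)\<bar>)\<^sup>2"
    using cos_double_sin[of "s / 2"] sin_cos_squared_add[of s]
    by (simp add: cmod_power2 power2_diff power_mult_distrib)
  then show ?thesis by (subst (asm) power2_eq_iff_nonneg) auto
qed

lemma chord_le_arc: "norm (cis s - 1) \<le> \<bar>s\<bar>"
  using abs_sin_x_le_abs_x[of "s / 2"] by (simp add: norm_cis_minus_1)

text \<open>Jordan's inequality: the sine is concave on the interval, so its graph lies above the chord from the
  origin to \<open>(pi / 2, 1)\<close>.\<close>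

lemma jordan_sin_ge:
  assumes "0 \<le> x" "x \<le> pi / 2"
  shows "2 / pi * x \<le> sin x"
proof -
  have "concave_on {0..pi/2} (sin :: real \<Rightarrow> real)"
    by (rule f''_le0_imp_concave[where f' = cos and f'' = "\<lambda>x. - sin x"])
       (auto intro!: derivative_eq_intros sin_ge_zero)
  from concave_onD_Icc'[OF this, of x] assms show ?thesis by (simp add: field_simps)
qed

text \<open>Jordan's inequality gives the factor \<open>2 / pi\<close>; the rational \<open>1 / 2\<close> is smaller because \<open>pi < 4\<close>.\<close>

lemma chord_ge_arc:
  assumes "\<bar>s\<bar> \<le> pi"
  shows "\<bar>s\<bar> / 2 \<le> norm (cis s - 1)"
proof -
  have "1/4 * \<bar>s\<bar> \<le> 2 / pi * (\<bar>s\<bar> / 2)"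
    using pi_less_4 mult_right_mono[of pi 4 "\<bar>s\<bar>"] by (simp add: field_simps)
  also have "\<dots> \<le> sin (\<bar>s\<bar> / 2)"
    using assms by (intro jordan_sin_ge) auto
  also have "\<dots> \<le> \<bar>sin (s / 2)\<bar>"
    by (auto simp: abs_if)
  finally show ?thesis by (simp add: norm_cis_minus_1)
qed

lemma norm_cis_diff: "norm (cis x - cis t) = norm (cis (x - t) - 1)"
proof -
  have "cis x - cis t = cis t * (cis (x - t) - 1)"
    by (simp add: algebra_simps cis_mult)
  then show ?thesis by (simp add: norm_mult)
qed

text \<open>Shifting by one full turn if necessary brings the angular difference into \<open>[-pi, pi]\<close>.\<close>

lemma chord_ge_arc_mod_2pi:
  assumes "\<bar>x - t\<bar> < 2 * pi"
  shows "\<exists>k\<in>{-1, 0, 1}. \<bar>x - (t + 2 * pi * k)\<bar> / 2 \<le> norm (cis x - cis t)"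
proof -
  define k :: real where "k = (if x - t > pi then 1 else if x - t < - pi then -1 else 0)"
  have "cis t = cis (t + 2 * pi * k)"
    using cis_2pi cis_mult[of t "2 * pi * k"]
    by (auto simp: k_def cis_cnj[of "2 * pi", symmetric] simp del: cis_mult)
  then have "norm (cis x - cis t) = norm (cis (x - (t + 2 * pi * k)) - 1)"
    by (metis norm_cis_diff)
  moreover have "\<bar>x - (t + 2 * pi * k)\<bar> \<le> pi"
    using assms by (auto simp: k_def abs_if split: if_splits)
  ultimately have "\<bar>x - (t + 2 * pi * k)\<bar> / 2 \<le> norm (cis x - cis t)"
    using chord_ge_arc by metis
  moreover have "k \<in> {-1, 0, 1}" by (simp add: k_def)
  ultimately show ?thesis by blast
qed

text \<open>The integrand has the primitive \<open>2 a arctan ((x - t) / (2 a))\<close>, whose total variation is \<open>2 pi a\<close>.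
  The linear dependence on \<open>a\<close> is what produces \<open>sqrt (c n)\<close> in the main result.\<close>

lemma nn_integral_cauchy_kernel_le:
  fixes a b p t :: real
  assumes "a > 0" "p \<le> b"
  shows "(\<integral>\<^sup>+x. ennreal (a\<^sup>2 / (a\<^sup>2 + ((x - t) / 2)\<^sup>2)) * indicator {p..b} x \<partial>lborel) \<le> ennreal (2 * pi * a)"
proof -
  let ?F = "\<lambda>x. 2 * a * arctan ((x - t) / (2 * a))"
  have "((\<lambda>x. a\<^sup>2 / (a\<^sup>2 + ((x - t) / 2)\<^sup>2)) has_integral (?F b - ?F p)) {p..b}"
  proof (rule fundamental_theorem_of_calculus[OF \<open>p \<le> b\<close>])
    fix x
    have "a\<^sup>2 / (a\<^sup>2 + ((x - t) / 2)\<^sup>2) = 2 * a * (inverse (1 + ((x - t) / (2 * a))\<^sup>2) * (1 / (2 * a)))"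
      using assms by (simp add: divide_simps power2_eq_square)
    then have "(?F has_real_derivative a\<^sup>2 / (a\<^sup>2 + ((x - t) / 2)\<^sup>2)) (at x within {p..b})"
      using assms by (auto intro!: derivative_eq_intros)
    then show "(?F has_vector_derivative a\<^sup>2 / (a\<^sup>2 + ((x - t) / 2)\<^sup>2)) (at x within {p..b})"
      by (simp add: has_real_derivative_iff_has_vector_derivative)
  qed
  then have "(\<integral>\<^sup>+x. ennreal (a\<^sup>2 / (a\<^sup>2 + ((x - t) / 2)\<^sup>2)) * indicator {p..b} x \<partial>lborel) = ennreal (?F b - ?F p)"
    by (intro nn_integral_has_integral_lebesgue') auto
  also have "?F b - ?F p \<le> 2 * a * (pi / 2 - - (pi / 2))"
    unfolding right_diff_distrib[symmetric] using assms
    by (intro mult_left_mono diff_mono less_imp_le[OF arctan_ubound] less_imp_le[OF arctan_lbound]) auto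
  finally show ?thesis by (simp add: ennreal_leI mult.commute mult.left_commute)
qed

text \<open>The probability that none of the events with index \<open>m \<le> n < k\<close> occurs is a product of factors
  \<open>1 - p n \<le> exp (- p n)\<close>, hence at most \<open>exp (- (p m + \<dots> + p (k - 1)))\<close>, which is arbitrarily small when the
  series diverges. Phrasing the events through random variables makes their complements independent
  as well.\<close>

lemma (in prob_space) second_borel_cantelli_AE:
  assumes indep: "indep_vars N X UNIV"
    and B: "\<And>n::nat. B n \<in> sets (N n)"
    and div: "\<not> summable (\<lambda>n. prob (X n -` B n \<inter> space M))"
  shows "AE \<omega> in M. infinite {n. X n \<omega> \<in> B n}"
proof -
  have X[measurable]: "X n \<in> measurable M (N n)" for n
    using indep by (simp add: indep_vars_def)
  note [measurable] = B
  let ?p = "\<lambda>n. prob (X n -` B n \<inter> space M)"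
  have "AE \<omega> in M. \<exists>n\<ge>m. X n \<omega> \<in> B n" for m
  proof -
    let ?E = "{\<omega> \<in> space M. \<forall>n\<ge>m. X n \<omega> \<notin> B n}"
    have E_le: "prob ?E \<le> exp (- (\<Sum>n=m..<k. ?p n))" if "m < k" for k
    proof -
      have "prob ?E \<le> prob (\<Inter>n\<in>{m..<k}. X n -` (space (N n) - B n) \<inter> space M)"
        using that measurable_space[OF X] by (intro finite_measure_mono) (auto intro!: sets.finite_INT)
      also have "\<dots> = (\<Prod>n=m..<k. prob (X n -` (space (N n) - B n) \<inter> space M))"
        using that by (intro indep_varsD_finite[OF indep_vars_subset[OF indep]]) auto
      also have "\<dots> = (\<Prod>n=m..<k. 1 - ?p n)"
      proof (rule prod.cong[OF refl])
        fix n
        have "X n -` (space (N n) - B n) \<inter> space M = space M - X n -` B n \<inter> space M"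
          using measurable_space[OF X] by auto
        then show "prob (X n -` (space (N n) - B n) \<inter> space M) = 1 - ?p n"
          by (simp add: prob_compl)
      qed
      also have "\<dots> \<le> (\<Prod>n=m..<k. exp (- ?p n))"
        using exp_ge_add_one_self[of "- ?p n" for n] by (intro prod_mono) auto
      also have "\<dots> = exp (- (\<Sum>n=m..<k. ?p n))"
        by (simp add: exp_sum[symmetric] sum_negf)
      finally show ?thesis .
    qed
    \<comment> \<open>Otherwise \<open>- ln (prob E)\<close> would bound all partial sums of the divergent series.\<close>
    have "prob ?E = 0"
    proof (rule ccontr)
      assume "prob ?E \<noteq> 0"
      then have pos: "prob ?E > 0" using measure_nonneg[of M ?E] by linarith
      have "summable (\<lambda>n. ?p (n + m))"
      proof (rule summableI_nonneg_bounded)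
        fix k
        show "(\<Sum>n<k. ?p (n + m)) \<le> - ln (prob ?E)"
        proof (cases k)
          case 0 then show ?thesis using pos by simp
        next
          case (Suc j)
          then have "prob ?E \<le> exp (- (\<Sum>n=m..<k+m. ?p n))" by (intro E_le) simp
          from ln_mono[OF this pos] have "ln (prob ?E) \<le> - (\<Sum>n=m..<k+m. ?p n)" by simp
          also have "(\<Sum>n=m..<k+m. ?p n) = (\<Sum>n<k. ?p (n + m))"
            using sum.shift_bounds_nat_ivl[of ?p 0 m k] by (simp add: atLeast0LessThan)
          finally show ?thesis by simp
        qed
      qed simp
      with div show False using summable_iff_shift[of ?p m] by blast
    qed
    then have "emeasure M ?E = 0" by (simp add: emeasure_eq_measure)
    then show ?thesis
      by (intro AE_I[of _ _ ?E]) auto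
  qed
  then show ?thesis
    by (simp add: infinite_nat_iff_unbounded_le AE_all_countable)
qed

lemma borel_measurable_cis [measurable]: "cis \<in> borel_measurable borel"
  by (intro borel_measurable_continuous_onI continuous_intros)

lemma (in prob_space) AE_uniform_cis_neq:
  assumes [measurable]: "X \<in> borel_measurable M"
    and X: "distr M borel X = uniform_measure lborel {0..<2 * pi}"
    and t: "t \<in> {0..<2 * pi}"
  shows "AE \<omega> in M. cis (X \<omega>) \<noteq> cis t"
proof -
  have "AE x in lborel. x \<notin> {t, t + 2 * pi, t - 2 * pi}"
    by (intro AE_not_in finite_imp_null_set_lborel) simp
  then have "AE x in lborel. x \<in> {0..<2 * pi} \<longrightarrow> cis x \<noteq> cis t"
  proof eventually_elim
    case (elim x)
    show ?case
    proof (intro impI notI)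
      assume x: "x \<in> {0..<2 * pi}" "cis x = cis t"
      then have "\<bar>x - t\<bar> < 2 * pi" using t by auto
      from chord_ge_arc_mod_2pi[OF this] x(2) elim show False by auto
    qed
  qed
  then have "AE x in uniform_measure lborel {0..<2 * pi}. cis x \<noteq> cis t"
    by (subst AE_uniform_measure) auto
  then have "AE x in distr M borel X. cis x \<noteq> cis t" unfolding X .
  then show ?thesis by (subst (asm) AE_distr_iff) auto
qed

text \<open>By the comparison of chords with arcs, the integrand is at most the sum of three Cauchy kernels,
  centred at \<open>t\<close> and its translates by one turn. Each has integral at most \<open>2 pi a\<close>; dividing by the length \<open>2 pi\<close>
  leaves \<open>3 a\<close>.\<close>

lemma (in prob_space) nn_integral_uniform_chord_le:
  assumes [measurable]: "X \<in> borel_measurable M"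
    and X: "distr M borel X = uniform_measure lborel {0..<2 * pi}"
    and t: "t \<in> {0..<2 * pi}" and a: "a \<ge> 0"
  shows "(\<integral>\<^sup>+\<omega>. ennreal (a\<^sup>2 / (a\<^sup>2 + (norm (cis (X \<omega>) - cis t))\<^sup>2)) \<partial>M) \<le> ennreal (3 * a)"
proof (cases "a = 0")
  case False
  with a have a: "a > 0" by simp
  let ?f = "\<lambda>k x. ennreal (a\<^sup>2 / (a\<^sup>2 + ((x - (t + 2 * pi * k)) / 2)\<^sup>2)) * indicator {0..2 * pi} x"
  let ?g = "\<lambda>x. ennreal (a\<^sup>2 / (a\<^sup>2 + (norm (cis x - cis t))\<^sup>2))"
  have "(\<integral>\<^sup>+x. ?g x * indicator {0..<2 * pi} x \<partial>lborel) \<le> (\<integral>\<^sup>+x. (\<Sum>k\<in>{-1, 0, 1::real}. ?f k x) \<partial>lborel)"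
  proof (rule nn_integral_mono)
    fix x
    show "?g x * indicator {0..<2 * pi} x \<le> (\<Sum>k\<in>{-1, 0, 1::real}. ?f k x)"
    proof (cases "x \<in> {0..<2 * pi}")
      case True
      then have "\<bar>x - t\<bar> < 2 * pi" using t by auto
      then obtain k :: real where k: "k \<in> {-1, 0, 1}"
        "\<bar>x - (t + 2 * pi * k)\<bar> / 2 \<le> norm (cis x - cis t)"
        using chord_ge_arc_mod_2pi by blast
      have "((x - (t + 2 * pi * k)) / 2)\<^sup>2 \<le> (norm (cis x - cis t))\<^sup>2"
        using power_mono[OF k(2), of 2] by (simp add: power_divide)
      then have "?g x \<le> ennreal (a\<^sup>2 / (a\<^sup>2 + ((x - (t + 2 * pi * k)) / 2)\<^sup>2))"
        using a by (intro ennreal_leI divide_left_mono add_mono mult_pos_pos add_pos_nonneg) auto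
      then have "?g x * indicator {0..<2 * pi} x \<le> ?f k x"
        using True by simp
      also have "\<dots> \<le> (\<Sum>k\<in>{-1, 0, 1::real}. ?f k x)"
        by (rule sum_nonneg_leq_bound[OF _ _ refl k(1)]) auto
      finally show ?thesis .
    qed auto
  qed
  also have "\<dots> = (\<Sum>k\<in>{-1, 0, 1::real}. \<integral>\<^sup>+x. ?f k x \<partial>lborel)"
    by (rule nn_integral_sum) measurable
  also have "\<dots> \<le> (\<Sum>k\<in>{-1, 0, 1::real}. ennreal (2 * pi * a))"
    using a by (intro sum_mono nn_integral_cauchy_kernel_le) auto
  also have "\<dots> = ennreal (\<Sum>k\<in>{-1, 0, 1::real}. 2 * pi * a)"
    using a by (intro sum_ennreal) simp
  also have "(\<Sum>k\<in>{-1, 0, 1::real}. 2 * pi * a) = 6 * pi * a" by simp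
  finally have *: "(\<integral>\<^sup>+x. ?g x * indicator {0..<2 * pi} x \<partial>lborel) \<le> ennreal (6 * pi * a)" .
  have "(\<integral>\<^sup>+\<omega>. ?g (X \<omega>) \<partial>M) = (\<integral>\<^sup>+x. ?g x \<partial>distr M borel X)"
    by (subst nn_integral_distr) auto
  also have "\<dots> = (\<integral>\<^sup>+x. ?g x * indicator {0..<2 * pi} x \<partial>lborel) / ennreal (2 * pi)"
    unfolding X by (subst nn_integral_uniform_measure) auto
  also have "\<dots> \<le> ennreal (6 * pi * a) / ennreal (2 * pi)"
    by (rule divide_right_mono_ennreal[OF *])
  also have "\<dots> = ennreal (3 * a)"
    using a by (simp add: divide_ennreal)
  finally show ?thesis .
qed simp

text \<open>Chords are shorter than arcs, so the event contains an interval of angles of length \<open>a\<close> with endpoint \<open>t\<close>.\<close>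

lemma (in prob_space) prob_uniform_chord_ge:
  assumes [measurable]: "X \<in> borel_measurable M"
    and X: "distr M borel X = uniform_measure lborel {0..<2 * pi}"
    and t: "t \<in> {0..<2 * pi}" and a: "0 \<le> a" "a \<le> 1"
  shows "a / (2 * pi) \<le> prob (X -` {x. norm (cis x - cis t) < a} \<inter> space M)"
proof -
  let ?B = "{x. norm (cis x - cis t) < a}"
  \<comment> \<open>The interval lies on whichever side of \<open>t\<close> stays inside \<open>[0, 2 pi)\<close>.\<close>
  define J where "J = (if t \<le> pi then {t<..<t + a} else {t - a<..<t})"
  have J: "J \<subseteq> {0..<2 * pi} \<inter> ?B"
  proof
    fix x assume x: "x \<in> J"
    then have "\<bar>x - t\<bar> < a" by (auto simp: J_def split: if_splits)
    then have "norm (cis x - cis t) < a"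
      using chord_le_arc[of "x - t"] by (simp add: norm_cis_diff)
    moreover have "x \<in> {0..<2 * pi}"
      using x a t pi_gt3 by (auto simp: J_def split: if_splits)
    ultimately show "x \<in> {0..<2 * pi} \<inter> ?B" by simp
  qed
  have "emeasure lborel J = ennreal a"
    using a by (auto simp: J_def)
  then have "ennreal a / ennreal (2 * pi) \<le> emeasure lborel ({0..<2 * pi} \<inter> ?B) / ennreal (2 * pi)"
    using emeasure_mono[OF J, of lborel] by (intro divide_right_mono_ennreal) auto
  also have "\<dots> = emeasure (distr M borel X) ?B"
    unfolding X by (subst emeasure_uniform_measure) auto
  also have "\<dots> = ennreal (prob (X -` ?B \<inter> space M))"
    by (subst emeasure_distr) (auto simp: emeasure_eq_measure)
  finally show ?thesis
    using a by (simp add: divide_ennreal ennreal_le_iff)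
qed

section \<open>The random series\<close>

text \<open>The terms with positive weight have infinite expectation. The damped terms \<open>c / (c + d\<^sup>2)\<close> have expectation at
  most \<open>3 sqrt c\<close>, so their sum is almost surely finite; their convergence to 0 forces \<open>c < d\<^sup>2\<close>
  eventually, and from then on they are at least half of the original terms.\<close>

lemma (in prob_space) AE_summable_if_summable_sqrt:
  assumes indep: "\<And>n. X n \<in> borel_measurable M"
    and X: "\<And>n. distr M borel (X n) = uniform_measure lborel {0..<2 * pi}"
    and t: "t \<in> {0..<2 * pi}" and c: "\<And>n::nat. 0 \<le> c n"
    and summ: "summable (\<lambda>n. sqrt (c n))"
  shows "AE \<omega> in M. summable (\<lambda>n. c n / (norm (cis (X n \<omega>) - cis t))\<^sup>2)"
proof -
  note [measurable] = indep
  define Y where "Y = (\<lambda>n \<omega>. c n / (c n + (norm (cis (X n \<omega>) - cis t))\<^sup>2))"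
  have Y_nonneg: "0 \<le> Y n \<omega>" for n \<omega> using c[of n] by (simp add: Y_def)
  have [measurable]: "Y n \<in> borel_measurable M" for n unfolding Y_def by measurable
  have "(\<integral>\<^sup>+\<omega>. (\<Sum>n. ennreal (Y n \<omega>)) \<partial>M) = (\<Sum>n. \<integral>\<^sup>+\<omega>. ennreal (Y n \<omega>) \<partial>M)"
    by (rule nn_integral_suminf) measurable
  also have "\<dots> \<le> (\<Sum>n. ennreal (3 * sqrt (c n)))"
  proof (intro suminf_le summableI)
    fix n
    show "(\<integral>\<^sup>+\<omega>. ennreal (Y n \<omega>) \<partial>M) \<le> ennreal (3 * sqrt (c n))"
      using nn_integral_uniform_chord_le[OF indep X t, of "sqrt (c n)" n] c[of n] by (simp add: Y_def)
  qed
  also have "\<dots> < \<infinity>"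
    using summable_mult[OF summ, of 3] c by (subst suminf_ennreal2) auto
  finally have "AE \<omega> in M. (\<Sum>n. ennreal (Y n \<omega>)) \<noteq> \<infinity>"
    by (intro nn_integral_PInf_AE) auto
  moreover have "AE \<omega> in M. \<forall>n. cis (X n \<omega>) \<noteq> cis t"
    unfolding AE_all_countable using AE_uniform_cis_neq[OF indep X t] by blast
  ultimately show ?thesis
  proof eventually_elim
    case (elim \<omega>)
    have sY: "summable (\<lambda>n. Y n \<omega>)"
      using elim(1) Y_nonneg by (intro summable_suminf_not_top) auto
    then have "\<forall>\<^sub>F n in sequentially. Y n \<omega> < 1 / 2"
      using summable_LIMSEQ_zero by (intro order_tendstoD(2)[of _ 0]) auto
    then have "\<forall>\<^sub>F n in sequentially. norm (c n / (norm (cis (X n \<omega>) - cis t))\<^sup>2) \<le> 2 * Y n \<omega>"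
    proof eventually_elim
      case (elim n)
      let ?d = "(norm (cis (X n \<omega>) - cis t))\<^sup>2"
      have d: "?d > 0" using \<open>\<forall>n. cis (X n \<omega>) \<noteq> cis t\<close> by simp
      then have "c n + ?d > 0" using c[of n] by (simp add: add_nonneg_pos)
      then have "c n < ?d"
        using elim by (simp add: Y_def divide_less_eq)
      then have "1 / ?d \<le> 2 / (c n + ?d)"
        using d \<open>c n + ?d > 0\<close> by (simp add: divide_simps)
      from mult_left_mono[OF this c[of n]] show ?case
        using d c[of n] by (simp add: Y_def mult_ac)
    qed
    then show ?case
      by (rule summable_comparison_test_ev[OF _ summable_mult[OF sY]])
  qed
qed

text \<open>A term exceeds 1 as soon as the atom lies within \<open>sqrt (c n)\<close> of the point. These independent
  events have probabilities at least \<open>sqrt (c n) / (2 pi)\<close>, so infinitely many of them occur.\<close>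

lemma (in prob_space) AE_not_summable_if_not_summable_sqrt:
  assumes indep: "indep_vars (\<lambda>_. borel) X UNIV"
    and X: "\<And>n. distr M borel (X n) = uniform_measure lborel {0..<2 * pi}"
    and t: "t \<in> {0..<2 * pi}" and c: "\<And>n::nat. 0 \<le> c n" "\<And>n. c n \<le> 1"
    and div: "\<not> summable (\<lambda>n. sqrt (c n))"
  shows "AE \<omega> in M. \<not> summable (\<lambda>n. c n / (norm (cis (X n \<omega>) - cis t))\<^sup>2)"
proof -
  have Xm: "X n \<in> borel_measurable M" for n
    using indep by (simp add: indep_vars_def)
  let ?B = "\<lambda>n. {x. norm (cis x - cis t) < sqrt (c n)}"
  have "\<not> summable (\<lambda>n. prob (X n -` ?B n \<inter> space M))"
  proof
    assume "summable (\<lambda>n. prob (X n -` ?B n \<inter> space M))"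
    then have "summable (\<lambda>n. sqrt (c n) / (2 * pi))"
    proof (rule summable_comparison_test'[where N = 0])
      show "norm (sqrt (c n) / (2 * pi)) \<le> prob (X n -` ?B n \<inter> space M)" for n
        using prob_uniform_chord_ge[OF Xm X t, of "sqrt (c n)" n] c[of n] by simp
    qed
    from summable_mult[OF this, of "2 * pi"] div show False by simp
  qed
  then have "AE \<omega> in M. infinite {n. X n \<omega> \<in> ?B n}"
    by (intro second_borel_cantelli_AE[OF indep]) auto
  moreover have "AE \<omega> in M. \<forall>n. cis (X n \<omega>) \<noteq> cis t"
    unfolding AE_all_countable using AE_uniform_cis_neq[OF Xm X t] by blast
  ultimately show ?thesis
  proof eventually_elim
    case (elim \<omega>)
    show ?case
    proof
      assume "summable (\<lambda>n. c n / (norm (cis (X n \<omega>) - cis t))\<^sup>2)"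
      then have "\<forall>\<^sub>F n in sequentially. c n / (norm (cis (X n \<omega>) - cis t))\<^sup>2 < 1"
        using summable_LIMSEQ_zero by (intro order_tendstoD(2)[of _ 0]) auto
      then obtain N where "\<And>n. n \<ge> N \<Longrightarrow> c n / (norm (cis (X n \<omega>) - cis t))\<^sup>2 < 1"
        by (auto simp: eventually_sequentially)
      moreover obtain n where "n \<ge> N" "X n \<omega> \<in> ?B n"
        using elim(1) unfolding infinite_nat_iff_unbounded_le by blast
      ultimately have n: "norm (cis (X n \<omega>) - cis t) < sqrt (c n)"
        "c n / (norm (cis (X n \<omega>) - cis t))\<^sup>2 < 1" by auto
      have "(norm (cis (X n \<omega>) - cis t))\<^sup>2 < (sqrt (c n))\<^sup>2"
        by (rule power_strict_mono[OF n(1)]) auto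
      with n(2) elim(2) c(1)[of n] show False by (simp add: divide_less_eq)
    qed
  qed
qed

theorem theorem1p2:
  fixes M :: "'a measure"
    and c :: "nat \<Rightarrow> real"
    and \<theta> :: "nat \<Rightarrow> 'a \<Rightarrow> real"
    and \<phi> :: "'a \<Rightarrow> complex \<Rightarrow> complex"
  assumes "prob_space M"
    and "\<And>n. 0 \<le> c n"
    and "c sums 1"
    and "prob_space.indep_vars M (\<lambda>_. borel) \<theta> UNIV"
    and "\<And>n. distr M borel (\<theta> n) = uniform_measure lborel {0..<2 * pi}"
    and "\<And>\<omega>. \<phi> \<omega> = associated_inner (atomic_measure c (\<lambda>n. cis (\<theta> n \<omega>)))"
  shows "(summable (\<lambda>n. sqrt (c n)) \<longrightarrow>
            (\<forall>\<xi>\<in>sphere 0 1. AE \<omega> in M. admits_angular_derivative (\<phi> \<omega>) \<xi>)) \<and>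
         (\<not> summable (\<lambda>n. sqrt (c n)) \<longrightarrow>
            (\<forall>\<xi>\<in>sphere 0 1. AE \<omega> in M. \<not> admits_angular_derivative (\<phi> \<omega>) \<xi>))"
proof -
  interpret prob_space M by fact
  have atoms: "circle_atoms c (\<lambda>n. cis (\<theta> n \<omega>))" for \<omega>
    using assms(2,3) by unfold_locales auto
  have \<theta>: "\<theta> n \<in> borel_measurable M" for n
    using assms(4) by (simp add: indep_vars_def)
  have c_le_1: "c n \<le> 1" for n
    using sum_le_suminf[of c "{n}"] assms(2,3) by (simp add: sums_iff)
  have polar: "\<exists>t\<in>{0..<2 * pi}. \<xi> = cis t" if "\<xi> \<in> sphere 0 1" for \<xi> :: complex
    using that Arg2pi[of \<xi>] by (intro bexI[of _ "Arg2pi \<xi>"]) (auto simp: is_Arg_def cis_conv_exp mult.commute)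
  \<comment> \<open>Almost surely no atom sits at the point, so the deterministic criterion applies.\<close>
  have iff: "AE \<omega> in M. admits_angular_derivative (\<phi> \<omega>) (cis t) \<longleftrightarrow>
      summable (\<lambda>n. c n / (norm (cis (\<theta> n \<omega>) - cis t))\<^sup>2)" if t: "t \<in> {0..<2 * pi}" for t
  proof -
    have "AE \<omega> in M. \<forall>n. cis (\<theta> n \<omega>) \<noteq> cis t"
      unfolding AE_all_countable using AE_uniform_cis_neq[OF \<theta> assms(5) t] by blast
    then show ?thesis
    proof eventually_elim
      case (elim \<omega>)
      then show ?case
        unfolding assms(6)
        using circle_atoms.admits_angular_derivative_if_summable[OF atoms, of "cis t" \<omega>]
          circle_atoms.summable_if_admits_angular_derivative[OF atoms, of "cis t" \<omega>]
        by (auto simp: eq_commute)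
    qed
  qed
  show ?thesis
  proof (intro conjI impI ballI)
    fix \<xi> :: complex
    assume s: "summable (\<lambda>n. sqrt (c n))" and "\<xi> \<in> sphere 0 1"
    then obtain t where t: "t \<in> {0..<2 * pi}" "\<xi> = cis t" using polar by blast
    from iff[OF t(1)] AE_summable_if_summable_sqrt[where X = \<theta> and c = c, OF \<theta> assms(5) t(1) assms(2) s]
    show "AE \<omega> in M. admits_angular_derivative (\<phi> \<omega>) \<xi>"
      unfolding t(2) by eventually_elim blast
  next
    fix \<xi> :: complex
    assume s: "\<not> summable (\<lambda>n. sqrt (c n))" and "\<xi> \<in> sphere 0 1"
    then obtain t where t: "t \<in> {0..<2 * pi}" "\<xi> = cis t" using polar by blast
    from iff[OF t(1)] AE_not_summable_if_not_summable_sqrt[where X = \<theta> and c = c, OF assms(4,5) t(1) assms(2) c_le_1 s]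
    show "AE \<omega> in M. \<not> admits_angular_derivative (\<phi> \<omega>) \<xi>"
      unfolding t(2) by eventually_elim blast
  qed
qed

end
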